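(* Let $\lambda,\alpha,\beta,\varphi$ be real numbers. Then the operator $\mathbf{H}_{\lambda,\alpha,\beta}$ is bounded from $l_{\varphi}^1$ to $L^{\infty}$ if and only if both $$\lambda\geq\beta\geq 0\qquad\text{and}\qquad \lambda\geq\alpha+\beta-\varphi$$ hold.
   Context: Let $\mathbb{R}_{+}=(0,+\infty)$ and $\mathbb{N}=\{1,2,3,\dots\}$. For real $\lambda,\alpha,\beta$ and a real sequence $a=\{a_m\}_{m=1}^{\infty}$, define $$\mathbf{H}_{\lambda,\alpha,\beta}a(x):=\sum_{m=1}^{\infty}\frac{m^{\alpha}x^{\beta}}{[\max\{m,x\}]^{\lambda}}a_m,\quad x\in\mathbb{R}_{+}.$$ For $\theta\in\mathbb{R}$, $l_\theta^1$ is the space of real sequences with $\|a\|_{1,\theta}=\sum_{n=1}^\infty n^\theta|a_n|<\infty$. $L^\infty$ is the space of real-valued measurable functions $f$ on $\mathbb{R}_{+}$ with $\|f\|_\infty=\operatorname{ess\,sup}_{x\in\mathbb{R}_{+}}|f(x)|<\infty$. The operator is bounded from a sequence space $X$ to a function space $Y$ if for every $a\in X$ the defining series converges for a.e. $x\in\mathbb{R}_{+}$ and there is a constant $C$ with $\|\mathbf{H}_{\lambda,\alpha,\beta}a\|_Y\le C\|a\|_X$ for all $a\in X$. *)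

theory Defs
  imports "HOL-Probability.Essential_Supremum"
begin

text \<open>Sequences \<open>a\<^sub>1, a\<^sub>2, \<dots>\<close> are functions on \<^typ>\<open>nat\<close> whose value at \<open>0\<close> is never used; a series
  over \<open>m = 1, 2, \<dots>\<close> is written as a series over \<open>k = 0, 1, \<dots>\<close> with \<open>m = Suc k\<close>.\<close>

definition H_term :: "real \<Rightarrow> real \<Rightarrow> real \<Rightarrow> (nat \<Rightarrow> real) \<Rightarrow> real \<Rightarrow> nat \<Rightarrow> real" where
  "H_term lam \<alpha> \<beta> a x m =
     real m powr \<alpha> * x powr \<beta> / (max (real m) x) powr lam * a m"

definition H_op :: "real \<Rightarrow> real \<Rightarrow> real \<Rightarrow> (nat \<Rightarrow> real) \<Rightarrow> real \<Rightarrow> real" where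
  "H_op lam \<alpha> \<beta> a x = (\<Sum>k. H_term lam \<alpha> \<beta> a x (Suc k))"

definition l1_space :: "real \<Rightarrow> (nat \<Rightarrow> real) set" where
  "l1_space \<theta> = {a. summable (\<lambda>k. real (Suc k) powr \<theta> * \<bar>a (Suc k)\<bar>)}"

definition l1_norm :: "real \<Rightarrow> (nat \<Rightarrow> real) \<Rightarrow> real" where
  "l1_norm \<theta> a = (\<Sum>k. real (Suc k) powr \<theta> * \<bar>a (Suc k)\<bar>)"

abbreviation Rplus_measure :: "real measure" where
  "Rplus_measure \<equiv> lebesgue_on {0<..}"

definition Linf_norm :: "(real \<Rightarrow> real) \<Rightarrow> ereal" where
  "Linf_norm f = esssup Rplus_measure (\<lambda>x. ereal \<bar>f x\<bar>)"

definition Linf_space :: "(real \<Rightarrow> real) set" where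
  "Linf_space = {f \<in> borel_measurable Rplus_measure. Linf_norm f < \<infinity>}"

definition H_bounded_l1_Linf :: "real \<Rightarrow> real \<Rightarrow> real \<Rightarrow> real \<Rightarrow> bool" where
  "H_bounded_l1_Linf lam \<alpha> \<beta> \<theta> \<longleftrightarrow>
     (\<forall>a \<in> l1_space \<theta>.
        (AE x in Rplus_measure. summable (\<lambda>k. H_term lam \<alpha> \<beta> a x (Suc k))) \<and>
        H_op lam \<alpha> \<beta> a \<in> Linf_space) \<and>
     (\<exists>C::real. \<forall>a \<in> l1_space \<theta>. Linf_norm (H_op lam \<alpha> \<beta> a) \<le> ereal (C * l1_norm \<theta> a))"

end

theory Submission
  imports Defs
begin

text \<open>
  Write \<open>K m x = m\<^sup>\<alpha> x\<^sup>\<beta> / (max m x)\<^sup>\<lambda>\<close> for the kernel. As always for operators out of a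
  weighted \<open>\<ell>\<^sup>1\<close>, boundedness into \<open>L\<^sup>\<infinity>\<close> is decided by the single columns: it is equivalent to
  \<open>K m x \<le> C m\<^sup>\<phi>\<close> for all \<open>m \<ge> 1\<close>, \<open>x > 0\<close> and some constant \<open>C\<close>. One direction
  (\<open>bounded_if_kernel_le\<close>) is the triangle inequality. The other one (\<open>kernel_le_if_bounded\<close>)
  tests the operator on the unit sequences; this gives the estimate for almost every \<open>x\<close>, hence
  for every \<open>x\<close>, because the kernel is continuous.

  If the exponents satisfy the three inequalities and \<open>M = max m x\<close>, then
  \<open>x\<^sup>\<beta> \<le> M\<^sup>\<beta>\<close> as \<open>\<beta> \<ge> 0\<close>, next \<open>M\<^bsup>\<beta>-\<lambda>\<^esup> \<le> m\<^bsup>\<beta>-\<lambda>\<^esup>\<close> as \<open>\<beta> \<le> \<lambda>\<close>, and finally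
  \<open>m\<^bsup>\<alpha>+\<beta>-\<lambda>\<^esup> \<le> m\<^sup>\<phi>\<close> as \<open>m \<ge> 1\<close>; so the estimate holds with \<open>C = 1\<close>. Conversely, the three
  inequalities are read off from the estimate along three paths on which \<open>K m x / m\<^sup>\<phi>\<close> is a pure
  power: \<open>m = 1, x \<rightarrow> 0\<close> forces \<open>\<beta> \<ge> 0\<close>, \<open>m = 1, x \<rightarrow> \<infinity>\<close> forces \<open>\<beta> \<le> \<lambda>\<close>, and
  \<open>x = m \<rightarrow> \<infinity>\<close> forces \<open>\<alpha> + \<beta> - \<lambda> \<le> \<phi>\<close>.
\<close>

definition H_kernel :: "real \<Rightarrow> real \<Rightarrow> real \<Rightarrow> nat \<Rightarrow> real \<Rightarrow> real" where
  "H_kernel lam \<alpha> \<beta> m x = real m powr \<alpha> * x powr \<beta> / (max (real m) x) powr lam"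

lemma H_term_eq_kernel: "H_term lam \<alpha> \<beta> a x m = H_kernel lam \<alpha> \<beta> m x * a m"
  by (simp add: H_term_def H_kernel_def)

lemma H_kernel_nonneg: "0 \<le> H_kernel lam \<alpha> \<beta> m x"
  by (simp add: H_kernel_def)

lemma continuous_on_H_kernel:
  "continuous_on {0<..} (H_kernel lam \<alpha> \<beta> m)"
  unfolding H_kernel_def by (intro continuous_intros) auto

lemma H_kernel_le:
  assumes "0 \<le> \<beta>" "\<beta> \<le> lam" "\<alpha> + \<beta> - \<phi> \<le> lam" "0 < m" "0 < x"
  shows "H_kernel lam \<alpha> \<beta> m x \<le> real m powr \<phi>"
proof -
  let ?M = "max (real m) x"
  have "H_kernel lam \<alpha> \<beta> m x \<le> real m powr \<alpha> * ?M powr \<beta> / ?M powr lam"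
    unfolding H_kernel_def using assms
    by (intro divide_right_mono mult_left_mono powr_mono2) auto
  also have "\<dots> = real m powr \<alpha> * ?M powr (\<beta> - lam)"
    by (simp add: powr_diff)
  also have "\<dots> \<le> real m powr \<alpha> * real m powr (\<beta> - lam)"
    using assms by (intro mult_left_mono powr_mono2') auto
  also have "\<dots> = real m powr (\<alpha> + \<beta> - lam)"
    by (simp add: powr_add powr_diff)
  also have "\<dots> \<le> real m powr \<phi>"
    using assms by (intro powr_mono) auto
  finally show ?thesis .
qed

lemma H_op_measurable: "H_op lam \<alpha> \<beta> a \<in> borel_measurable Rplus_measure"
proof -
  have "(\<lambda>x. \<Sum>k. H_term lam \<alpha> \<beta> a x (Suc k)) \<in> borel_measurable borel"
    unfolding H_term_def by measurable
  then have "H_op lam \<alpha> \<beta> a \<in> borel_measurable lborel"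
    by (simp add: H_op_def[abs_def])
  then show ?thesis
    by (intro measurable_restrict_space1 measurable_completion)
qed

lemma bounded_if_kernel_le:
  assumes K: "\<And>m x. 0 < m \<Longrightarrow> 0 < x \<Longrightarrow> H_kernel lam \<alpha> \<beta> m x \<le> C * real m powr \<phi>"
  shows "H_bounded_l1_Linf lam \<alpha> \<beta> \<phi>"
proof -
  have main: "summable (\<lambda>k. H_term lam \<alpha> \<beta> a x (Suc k)) \<and> \<bar>H_op lam \<alpha> \<beta> a x\<bar> \<le> C * l1_norm \<phi> a"
    if a: "a \<in> l1_space \<phi>" and x: "0 < x" for a x
  proof -
    let ?t = "\<lambda>k. H_term lam \<alpha> \<beta> a x (Suc k)"
    let ?b = "\<lambda>k. C * (real (Suc k) powr \<phi> * \<bar>a (Suc k)\<bar>)"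
    have le: "norm (?t k) \<le> ?b k" for k
      using mult_right_mono[OF K[of "Suc k" x], of "\<bar>a (Suc k)\<bar>"] x
      by (simp add: H_term_eq_kernel abs_mult H_kernel_nonneg mult.assoc del: of_nat_Suc)
    have sb: "summable ?b"
      using a unfolding l1_space_def by (intro summable_mult) simp
    have "norm (suminf ?t) \<le> suminf ?b"
      by (rule norm_suminf_le[OF le sb])
    also have "suminf ?b = C * l1_norm \<phi> a"
      using a unfolding l1_space_def l1_norm_def by (intro suminf_mult) simp
    finally show ?thesis
      using summable_comparison_test'[OF sb le] by (simp add: H_op_def)
  qed
  have norm_le: "Linf_norm (H_op lam \<alpha> \<beta> a) \<le> ereal (C * l1_norm \<phi> a)" if "a \<in> l1_space \<phi>" for a
    unfolding Linf_norm_def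
  proof (rule esssup_I)
    show "(\<lambda>x. ereal \<bar>H_op lam \<alpha> \<beta> a x\<bar>) \<in> borel_measurable Rplus_measure"
      using H_op_measurable by measurable
    show "AE x in Rplus_measure. ereal \<bar>H_op lam \<alpha> \<beta> a x\<bar> \<le> ereal (C * l1_norm \<phi> a)"
      using main[OF that] by (intro AE_I2) simp
  qed
  have "AE x in Rplus_measure. summable (\<lambda>k. H_term lam \<alpha> \<beta> a x (Suc k))"
    if "a \<in> l1_space \<phi>" for a
    using main[OF that] by (intro AE_I2) simp
  moreover have "H_op lam \<alpha> \<beta> a \<in> Linf_space" if "a \<in> l1_space \<phi>" for a
    using H_op_measurable le_less_trans[OF norm_le[OF that], of "\<infinity>"] by (simp add: Linf_space_def)
  ultimately show ?thesis
    unfolding H_bounded_l1_Linf_def by (intro conjI ballI exI[of _ C] norm_le)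
qed

text \<open>The set where a continuous function exceeds \<open>c\<close> is open, and a non-empty open set is not
  negligible.\<close>

lemma continuous_AE_le_imp_le:
  fixes f :: "real \<Rightarrow> real"
  assumes f: "continuous_on S f" and S: "open S"
    and ae: "AE x in lebesgue_on S. f x \<le> c" and x: "x \<in> S"
  shows "f x \<le> c"
proof (rule ccontr)
  assume "\<not> f x \<le> c"
  let ?U = "{x \<in> S. c < f x}"
  have U: "open ?U"
    using continuous_openin_preimage_gen[OF f, of "{c<..}"] S
    by (simp add: vimage_def Int_def openin_open_eq)
  then have meas: "?U \<in> sets lebesgue"
    by simp
  have "AE x in lebesgue. x \<in> S \<longrightarrow> f x \<le> c"
    using ae S by (simp add: AE_restrict_space_iff)
  then have "AE x in lebesgue. x \<notin> ?U"
    by eventually_elim auto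
  then have neg: "negligible ?U"
    using meas by (simp add: AE_iff_null_sets negligible_iff_null_sets)
  have "x \<in> ?U"
    using x \<open>\<not> f x \<le> c\<close> by simp
  then have "?U \<noteq> {}"
    by blast
  with open_not_negligible[OF U] neg show False
    by simp
qed

lemma kernel_le_if_bounded:
  assumes "H_bounded_l1_Linf lam \<alpha> \<beta> \<phi>"
  obtains C where "\<And>m x. 0 < m \<Longrightarrow> 0 < x \<Longrightarrow> H_kernel lam \<alpha> \<beta> m x \<le> C * real m powr \<phi>"
proof -
  obtain C where C: "\<And>a. a \<in> l1_space \<phi> \<Longrightarrow>
      Linf_norm (H_op lam \<alpha> \<beta> a) \<le> ereal (C * l1_norm \<phi> a)"
    using assms unfolding H_bounded_l1_Linf_def by blast
  have "H_kernel lam \<alpha> \<beta> m x \<le> C * real m powr \<phi>" if "0 < m" "0 < x" for m x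
  proof -
    obtain n where m: "m = Suc n"
      using \<open>0 < m\<close> gr0_conv_Suc by blast
    define e :: "nat \<Rightarrow> real" where "e = (\<lambda>k. if k = m then 1 else 0)"
    have norm_sums: "(\<lambda>k. real (Suc k) powr \<phi> * \<bar>e (Suc k)\<bar>) sums (real m powr \<phi>)"
      using sums_single[of n "\<lambda>k. real (Suc k) powr \<phi>"]
      by (simp add: e_def m if_distrib cong: if_cong)
    have op_sums: "(\<lambda>k. H_term lam \<alpha> \<beta> e y (Suc k)) sums H_kernel lam \<alpha> \<beta> m y" for y
      using sums_single[of n "\<lambda>k. H_kernel lam \<alpha> \<beta> (Suc k) y"]
      by (simp add: H_term_eq_kernel e_def m if_distrib cong: if_cong)
    have op: "H_op lam \<alpha> \<beta> e y = H_kernel lam \<alpha> \<beta> m y" for y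
      using op_sums by (simp add: H_op_def sums_iff)
    have "e \<in> l1_space \<phi>" and "l1_norm \<phi> e = real m powr \<phi>"
      using norm_sums by (simp_all add: l1_space_def l1_norm_def sums_iff)
    then have le: "Linf_norm (H_op lam \<alpha> \<beta> e) \<le> ereal (C * real m powr \<phi>)"
      using C by metis
    have "AE y in Rplus_measure. ereal \<bar>H_op lam \<alpha> \<beta> e y\<bar> \<le> Linf_norm (H_op lam \<alpha> \<beta> e)"
      unfolding Linf_norm_def by (rule esssup_AE)
    then have "AE y in Rplus_measure. H_kernel lam \<alpha> \<beta> m y \<le> C * real m powr \<phi>"
    proof eventually_elim
      case (elim y)
      from order_trans[OF elim le] show ?case
        by (simp add: op H_kernel_nonneg)
    qed
    then show ?thesis
      by (rule continuous_AE_le_imp_le[OF continuous_on_H_kernel open_greaterThan])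
        (use \<open>0 < x\<close> in simp)
  qed
  then show thesis by (rule that)
qed

text \<open>A power with non-zero exponent is unbounded at \<open>\<infinity>\<close> or at \<open>0\<close>, according to the sign of the
  exponent; so a bound at one of the two ends restricts the sign.\<close>

lemma powr_bounded_at_infinity_imp_nonpos:
  fixes \<gamma> C :: real
  assumes "\<And>n::nat. 0 < n \<Longrightarrow> real n powr \<gamma> \<le> C"
  shows "\<gamma> \<le> 0"
proof (rule ccontr)
  assume "\<not> \<gamma> \<le> 0"
  then have \<gamma>: "0 < \<gamma>" by simp
  let ?x = "(\<bar>C\<bar> + 1) powr (1 / \<gamma>)"
  obtain n :: nat where n: "?x \<le> real n"
    using real_arch_simple by blast
  have "0 < ?x" by simp
  with n have "0 < n"
    by (metis gr0I not_less of_nat_0)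
  have "\<bar>C\<bar> + 1 = ?x powr \<gamma>"
    using \<gamma> by (simp add: powr_powr)
  also have "\<dots> \<le> real n powr \<gamma>"
    using n \<gamma> by (intro powr_mono2) auto
  also have "\<dots> \<le> C"
    using assms \<open>0 < n\<close> by simp
  finally show False by simp
qed

lemma powr_bounded_at_0_imp_nonneg:
  fixes \<gamma> C :: real
  assumes "\<And>x. 0 < x \<Longrightarrow> x \<le> 1 \<Longrightarrow> x powr \<gamma> \<le> C"
  shows "0 \<le> \<gamma>"
proof -
  have "real n powr (- \<gamma>) \<le> C" if "0 < n" for n
    using assms[of "1 / real n"] that by (simp add: powr_divide powr_minus_divide)
  then show ?thesis
    using powr_bounded_at_infinity_imp_nonpos[of "- \<gamma>" C] by simp
qed

theorem theorem1p4:
  fixes lam \<alpha> \<beta> \<phi> :: real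
  shows "H_bounded_l1_Linf lam \<alpha> \<beta> \<phi> \<longleftrightarrow>
    (lam \<ge> \<beta> \<and> \<beta> \<ge> 0) \<and> lam \<ge> \<alpha> + \<beta> - \<phi>"
proof
  assume "H_bounded_l1_Linf lam \<alpha> \<beta> \<phi>"
  then obtain C where
    K: "\<And>m x. 0 < m \<Longrightarrow> 0 < x \<Longrightarrow> H_kernel lam \<alpha> \<beta> m x \<le> C * real m powr \<phi>"
    by (rule kernel_le_if_bounded) blast
  have "x powr \<beta> \<le> C" if "0 < x" "x \<le> 1" for x
    using K[of 1 x] that by (simp add: H_kernel_def max_def split: if_splits)
  then have "0 \<le> \<beta>"
    by (rule powr_bounded_at_0_imp_nonneg)
  moreover have "real n powr (\<beta> - lam) \<le> C" if "0 < n" for n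
    using K[of 1 "real n"] that by (simp add: H_kernel_def powr_diff max_def split: if_splits)
  then have "\<beta> - lam \<le> 0"
    by (rule powr_bounded_at_infinity_imp_nonpos)
  moreover have "real n powr (\<alpha> + \<beta> - lam - \<phi>) \<le> C" if "0 < n" for n
    using K[of n "real n"] that
    by (simp add: H_kernel_def powr_diff powr_add divide_le_eq mult_ac)
  then have "\<alpha> + \<beta> - lam - \<phi> \<le> 0"
    by (rule powr_bounded_at_infinity_imp_nonpos)
  ultimately show "(lam \<ge> \<beta> \<and> \<beta> \<ge> 0) \<and> lam \<ge> \<alpha> + \<beta> - \<phi>"
    by simp
next
  assume "(lam \<ge> \<beta> \<and> \<beta> \<ge> 0) \<and> lam \<ge> \<alpha> + \<beta> - \<phi>"
  then show "H_bounded_l1_Linf lam \<alpha> \<beta> \<phi>"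
    using H_kernel_le by (intro bounded_if_kernel_le[where C = 1]) auto
qed

end
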